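(* For all integers $n\ge 0$, \[ b(2n+1,n)=p(2n+1,n)=EC(n). \] Moreover, there exists an explicit bijection between $B(2n+1,n)$ and $P(2n+1,n)$.
   Context: For a permutation $\pi=\pi_1\cdots\pi_m\in S_m$, a position $i\in\{1,\dots,m-1\}$ is an ascent if $\pi_i<\pi_{i+1}$ and a descent if $\pi_i>\pi_{i+1}$. The permutation $\pi$ is called ballot if for every $1\le k\le m-1$, the number of ascents among positions $1,\dots,k$ is at least the number of descents among positions $1,\dots,k$. Let $B(m,d)$ be the set of ballot permutations in $S_m$ with exactly $d$ descents and $b(m,d)=|B(m,d)|$. For a cycle $\mathfrak c=(c_1,\dots,c_k)$ of a permutation (fixed points are cycles of length 1), let $\mathrm{cA}(\mathfrak c)$ be the number of $i\in\{1,\dots,k\}$ with $c_i\le c_{i+1}$ and $\mathrm{cD}(\mathfrak c)$ the number with $c_i>c_{i+1}$, where $c_{k+1}=c_1$; let $M(\mathfrak c)=\min(\mathrm{cA}(\mathfrak c),\mathrm{cD}(\mathfrak c))$, and for a permutation $\pi$ let $M(\pi)$ be the sum of $M$ over its cycles. Let $P(m,d)$ be the set of permutations in $S_m$ all of whose cycles have odd length and with $M(\pi)=d$, and $p(m,d)=|P(m,d)|$. $E(m,d)$ is the number of permutations of $[m]$ with exactly $d$ descents. The Eulerian–Catalan numbers are $EC(n)=2E(2n,n-1)$ for $n\ge1$, and $EC(0)=1$. *)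

theory Defs
  imports "HOL-Combinatorics.Cycles"
begin

text \<open>
  Elements of the symmetric group on \<open>{1..m}\<close> are functions \<open>\<pi> :: nat \<Rightarrow> nat\<close> with
  \<open>\<pi> permutes {1..m}\<close>; the one-line word of \<open>\<pi>\<close> is \<open>\<pi> 1, \<dots>, \<pi> m\<close>.
\<close>

definition ascents :: "(nat \<Rightarrow> nat) \<Rightarrow> nat \<Rightarrow> nat" where
  "ascents \<pi> k = card {i \<in> {1..k}. \<pi> i < \<pi> (i + 1)}"

definition descents :: "(nat \<Rightarrow> nat) \<Rightarrow> nat \<Rightarrow> nat" where
  "descents \<pi> k = card {i \<in> {1..k}. \<pi> i > \<pi> (i + 1)}"

definition ballot :: "nat \<Rightarrow> (nat \<Rightarrow> nat) \<Rightarrow> bool" where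
  "ballot m \<pi> \<longleftrightarrow> (\<forall>k. 1 \<le> k \<and> k \<le> m - 1 \<longrightarrow> descents \<pi> k \<le> ascents \<pi> k)"

definition ballot_perms :: "nat \<Rightarrow> nat \<Rightarrow> (nat \<Rightarrow> nat) set" where
  "ballot_perms m d = {\<pi>. \<pi> permutes {1..m} \<and> ballot m \<pi> \<and> descents \<pi> (m - 1) = d}"

definition cyc_ascents :: "nat list \<Rightarrow> nat" where
  "cyc_ascents c = card {i. i < length c \<and> c ! i \<le> c ! ((i + 1) mod length c)}"

definition cyc_descents :: "nat list \<Rightarrow> nat" where
  "cyc_descents c = card {i. i < length c \<and> c ! i > c ! ((i + 1) mod length c)}"

definition cyc_M :: "nat list \<Rightarrow> nat" where
  "cyc_M c = min (cyc_ascents c) (cyc_descents c)"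

text \<open>
  The list \<open>support \<pi> x\<close> is the cycle \<open>x, \<pi> x, \<pi> (\<pi> x), \<dots>\<close> of \<open>\<pi>\<close> through \<open>x\<close>. To list every cycle,
  fixed points included, exactly once, each is written with its least element first; the
  statistics above are invariant under rotation of the list.
\<close>

definition cycles_of :: "nat \<Rightarrow> (nat \<Rightarrow> nat) \<Rightarrow> nat list set" where
  "cycles_of m \<pi> = {support \<pi> x | x. x \<in> {1..m} \<and> (\<forall>y \<in> set (support \<pi> x). x \<le> y)}"

definition perm_M :: "nat \<Rightarrow> (nat \<Rightarrow> nat) \<Rightarrow> nat" where
  "perm_M m \<pi> = (\<Sum>c \<in> cycles_of m \<pi>. cyc_M c)"

definition odd_cycle_perms :: "nat \<Rightarrow> nat \<Rightarrow> (nat \<Rightarrow> nat) set" where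
  "odd_cycle_perms m d =
     {\<pi>. \<pi> permutes {1..m} \<and> (\<forall>c \<in> cycles_of m \<pi>. odd (length c)) \<and> perm_M m \<pi> = d}"

definition eulerian :: "nat \<Rightarrow> nat \<Rightarrow> nat" where
  "eulerian m d = card {\<pi>. \<pi> permutes {1..m} \<and> descents \<pi> (m - 1) = d}"

definition eulerian_catalan :: "nat \<Rightarrow> nat" where
  "eulerian_catalan n = (if n = 0 then 1 else 2 * eulerian (2 * n) (n - 1))"

text \<open>
  The one-line word \<open>\<pi> 1, \<dots>, \<pi> m\<close> read as the \<open>m\<close>-cycle \<open>\<pi> 1 \<mapsto> \<pi> 2 \<mapsto> \<dots> \<mapsto> \<pi> m \<mapsto> \<pi> 1\<close>.
\<close>

definition word_to_cycle :: "nat \<Rightarrow> (nat \<Rightarrow> nat) \<Rightarrow> (nat \<Rightarrow> nat)" where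
  "word_to_cycle m \<pi> = cycle_of_list (map \<pi> [1..<m + 1])"

end

theory Submission
  imports Defs
begin

text \<open>
  An odd cycle of length \<open>\<ell>\<close> contributes at most \<open>(\<ell> - 1) / 2\<close> to \<open>M\<close>, so \<open>P(2 n + 1, n)\<close> consists of
  the \<open>(2 n + 1)\<close>-cycles whose closed walk of cyclic ascents (\<open>+1\<close>) and descents (\<open>-1\<close>) ends at
  height \<open>1\<close> or \<open>-1\<close>. By the cycle lemma exactly one rotation of such a cyclic word starts with a
  Dyck path of length \<open>2 n\<close>, that is, exactly one is a ballot word with \<open>n\<close> descents. Rotating the
  maximal letter to the end instead and deleting it leaves a permutation of \<open>{1..2 n}\<close> with \<open>n - 1\<close>
  or \<open>n\<close> descents, and these two cases are equinumerous by complementation.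
\<close>

section \<open>The cycle lemma for walks with unit steps\<close>

text \<open>When the steps of \<open>S\<close> are \<open>1\<close> or \<open>-1\<close>, this says
  that the \<open>N - 1\<close> steps starting at \<open>k\<close> form a Dyck path. The
  \<open>N\<close>-th step, which completes a period, is left free.\<close>

definition balanced_from :: "nat \<Rightarrow> (nat \<Rightarrow> int) \<Rightarrow> nat \<Rightarrow> bool" where
  "balanced_from N S k \<longleftrightarrow> (\<forall>j<N. S k \<le> S (k + j)) \<and> S (k + (N - 1)) = S k"

text \<open>The starting point is read off from the minimum over one period: just after its last
  occurrence if the walk gains height per period, at its first occurrence if it loses
  height.\<close>

lemma balanced_from_exists:
  fixes S :: "nat \<Rightarrow> int"
  assumes N: "N > 0"
    and period: "\<And>j. S (j + N) = S j + \<sigma>" and \<sigma>: "\<bar>\<sigma>\<bar> = 1"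
    and step: "\<And>j. \<bar>S (Suc j) - S j\<bar> = 1"
  shows "\<exists>k. balanced_from N S k"
proof -
  define m where "m = Min (S ` {..<N})"
  define A where "A = {i. i < N \<and> S i = m}"
  have m_le: "m \<le> S i" if "i < N" for i
    unfolding m_def using that by (intro Min_le) auto
  have "m \<in> S ` {..<N}"
    unfolding m_def using N by (intro Min_in) auto
  then have A: "finite A" "A \<noteq> {}"
    by (auto simp: A_def)
  have "\<sigma> = 1 \<or> \<sigma> = -1" using \<sigma> by linarith
  then show ?thesis
  proof
    assume \<sigma>: "\<sigma> = 1"
    define p where "p = Max A"
    have "p \<in> A" unfolding p_def using A by (rule Max_in)
    then have p: "p < N" "S p = m" by (auto simp: A_def)
    \<comment> \<open>From index \<open>N\<close> on the walk repeats one unit higher, so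
      occurrences of the minimum at or before \<open>p\<close> come back at height
      \<open>m + 1\<close>.\<close>
    have after: "m + 1 \<le> S i" if "p < i" "i \<le> p + N" for i
    proof (cases "i < N")
      case True
      have "i \<notin> A" using that Max_ge[OF A(1), of i] by (auto simp: p_def)
      then show ?thesis using True m_le[of i] by (auto simp: A_def)
    next
      case False
      then have "S i = S (i - N) + 1" using period[of "i - N"] \<sigma> by simp
      moreover have "i - N < N" using False that p by linarith
      ultimately show ?thesis using m_le[of "i - N"] by simp
    qed
    have Sp: "S (Suc p) = m + 1"
      using after[of "Suc p"] step[of p] p N by simp
    moreover have "S (Suc p + (N - 1)) = m + 1"
      using period[of p] p N \<sigma> by simp
    ultimately have "balanced_from N S (Suc p)"
      unfolding balanced_from_def using after by simp
    then show ?thesis ..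
  next
    assume \<sigma>: "\<sigma> = -1"
    define q where "q = Min A"
    have "q \<in> A" unfolding q_def using A by (rule Min_in)
    then have q: "q < N" "S q = m" by (auto simp: A_def)
    have before: "m + 1 \<le> S i" if "i < q" for i
    proof -
      have "i \<notin> A" using that Min_le[OF A(1), of i] by (auto simp: q_def)
      then show ?thesis using that q m_le[of i] by (auto simp: A_def)
    qed
    \<comment> \<open>Past index \<open>N\<close> the walk repeats one unit lower, but only the part
      before \<open>q\<close> recurs here, and it was at height at least
      \<open>m + 1\<close>.\<close>
    have ge: "m \<le> S (q + j)" if "j < N" for j
    proof (cases "q + j < N")
      case True
      then show ?thesis by (rule m_le)
    next
      case False
      then have "S (q + j) = S (q + j - N) - 1" using period[of "q + j - N"] \<sigma> by simp
      moreover have "q + j - N < q" using False that by linarith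
      ultimately show ?thesis using before[of "q + j - N"] by simp
    qed
    have "S (Suc (q + (N - 1))) = m - 1"
      using period[of q] q N \<sigma> by simp
    \<comment> \<open>A unit step leads from here to height \<open>m - 1\<close>, so the height is
      \<open>m\<close> or \<open>m - 2\<close>; the lower bound excludes the latter.\<close>
    then have "S (q + (N - 1)) = m"
      using ge[of "N - 1"] step[of "q + (N - 1)"] N by simp
    then have "balanced_from N S q"
      unfolding balanced_from_def using ge q by simp
    then show ?thesis ..
  qed
qed

text \<open>Each window of length \<open>N\<close> meets the other, which forces
  \<open>S k = S l\<close>. As \<open>k + N\<close> lies in the window of \<open>l\<close>, the
  drift must be \<open>1\<close>; then \<open>l - 1\<close>, still in the window of
  \<open>k\<close>, would lie one below \<open>S k\<close>.\<close>

lemma balanced_from_unique: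
  fixes S :: "nat \<Rightarrow> int"
  assumes period: "\<And>j. S (j + N) = S j + \<sigma>" and \<sigma>: "\<bar>\<sigma>\<bar> = 1"
    and k: "balanced_from N S k" and l: "balanced_from N S l"
    and kl: "k < l" "l < k + N"
  shows False
proof -
  have ge_k: "S k \<le> S i" if "k \<le> i" "i < k + N" for i
    using k that unfolding balanced_from_def by (metis add_less_cancel_left le_add_diff_inverse)
  have ge_l: "S l \<le> S i" if "l \<le> i" "i < l + N" for i
    using l that unfolding balanced_from_def by (metis add_less_cancel_left le_add_diff_inverse)
  have end_k: "S (k + N - 1) = S k"
    using k kl unfolding balanced_from_def by simp
  have end_l: "S (l - 1 + N) = S l"
    using l kl unfolding balanced_from_def by simp
  have "S k \<le> S l" using ge_k[of l] kl by simp
  moreover have "S l \<le> S k" using ge_l[of "k + N - 1"] end_k kl by simp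
  moreover have "S l \<le> S k + \<sigma>" using ge_l[of "k + N"] period[of k] kl by simp
  moreover have "S k \<le> S (l - 1)" using ge_k[of "l - 1"] kl by simp
  moreover have "S l = S (l - 1) + \<sigma>" using end_l period[of "l - 1"] by simp
  ultimately show False using \<sigma> by linarith
qed


section \<open>Heights of cyclic words\<close>

text \<open>Both indices are reduced modulo the length, so the steps continue periodically and
  include the one from the last letter back to the first. Ties count as ascents, as in
  \<open>cyc_ascents\<close>.\<close>

definition cyc_step :: "nat list \<Rightarrow> nat \<Rightarrow> int" where
  "cyc_step xs i = (if xs ! (i mod length xs) \<le> xs ! (Suc i mod length xs) then 1 else -1)"

definition height :: "nat list \<Rightarrow> nat \<Rightarrow> int" where
  "height xs j = (\<Sum>i<j. cyc_step xs i)"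

lemma height_0 [simp]: "height xs 0 = 0"
  by (simp add: height_def)

lemma height_Suc: "height xs (Suc j) = height xs j + cyc_step xs j"
  by (simp add: height_def)

lemma abs_height_step: "\<bar>height xs (Suc j) - height xs j\<bar> = 1"
  by (simp add: height_Suc cyc_step_def)

lemma cyc_step_rotate:
  assumes "xs \<noteq> []"
  shows "cyc_step (rotate k xs) i = cyc_step xs (k + i)"
  using assms by (simp add: cyc_step_def nth_rotate mod_add_right_eq flip: add_Suc_right)

lemma height_rotate:
  assumes "xs \<noteq> []"
  shows "height (rotate k xs) j = height xs (k + j) - height xs k"
  by (induction j) (simp_all add: height_Suc cyc_step_rotate assms)

text \<open>Rotation by the full length is the identity, so the formula for heights of rotations
  becomes a period relation.\<close>

lemma height_period: "height xs (j + length xs) = height xs j + height xs (length xs)"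
  using height_rotate[of xs "length xs" j] by (cases "xs = []") (simp_all add: add.commute)

text \<open>Choosing a rotation is choosing a starting point on the periodic walk; the constant
  change of height cancels. The cycle lemma for walks thereby speaks about rotations of
  words.\<close>

lemma balanced_from_height_rotate:
  "xs \<noteq> [] \<Longrightarrow> balanced_from N (height (rotate k xs)) 0 \<longleftrightarrow> balanced_from N (height xs) k"
  by (simp add: balanced_from_def height_rotate)

lemma height_eq_card_diff:
  "height xs j = int (card {i. i < j \<and> cyc_step xs i = 1}) - int (card {i. i < j \<and> cyc_step xs i = -1})"
proof (induction j)
  case (Suc j)
  have "{i. i < Suc j \<and> P i} = (if P j then insert j {i. i < j \<and> P i} else {i. i < j \<and> P i})" for P
    by (auto simp: less_Suc_eq)
  then show ?case
    using Suc by (simp add: height_Suc) (auto simp: cyc_step_def)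
qed simp

lemma card_steps: "card {i. i < j \<and> cyc_step xs i = 1} + card {i. i < j \<and> cyc_step xs i = -1} = j"
proof (induction j)
  case (Suc j)
  have "{i. i < Suc j \<and> P i} = (if P j then insert j {i. i < j \<and> P i} else {i. i < j \<and> P i})" for P
    by (auto simp: less_Suc_eq)
  then show ?case
    using Suc by (simp) (auto simp: cyc_step_def)
qed simp

lemma cyc_ascents_eq: "cyc_ascents xs = card {i. i < length xs \<and> cyc_step xs i = 1}"
  unfolding cyc_ascents_def cyc_step_def by (rule arg_cong[of _ _ card]) auto

lemma cyc_descents_eq: "cyc_descents xs = card {i. i < length xs \<and> cyc_step xs i = -1}"
  unfolding cyc_descents_def cyc_step_def by (rule arg_cong[of _ _ card]) (auto simp: not_le)

lemma cyc_ascents_add_descents: "cyc_ascents xs + cyc_descents xs = length xs"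
  unfolding cyc_ascents_eq cyc_descents_eq by (rule card_steps)

lemma height_length: "height xs (length xs) = int (cyc_ascents xs) - int (cyc_descents xs)"
  unfolding cyc_ascents_eq cyc_descents_eq by (rule height_eq_card_diff)

text \<open>The two counts add up to \<open>2 * n + 1\<close>, so their minimum is \<open>n\<close>
  exactly when they are \<open>n\<close> and \<open>n + 1\<close> in some order.\<close>

lemma cyc_M_eq_iff:
  assumes "length xs = 2 * n + 1"
  shows "cyc_M xs = n \<longleftrightarrow> \<bar>height xs (length xs)\<bar> = 1"
  using cyc_ascents_add_descents[of xs] assms unfolding height_length cyc_M_def by linarith

text \<open>The height gained over a full period is invariant under rotation; together with the
  length it determines both counts.\<close>

lemma cyc_M_rotate: "cyc_M (rotate k xs) = cyc_M xs"
proof -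
  have "height (rotate k xs) (length (rotate k xs)) = height xs (length xs)"
    using height_period[of xs k] by (cases "xs = []") (simp_all add: height_rotate)
  then show ?thesis
    using cyc_ascents_add_descents[of xs] cyc_ascents_add_descents[of "rotate k xs"]
    unfolding height_length cyc_M_def by simp
qed

text \<open>Two counts with an odd sum differ, so twice the smaller one is strictly below the
  sum.\<close>

lemma double_cyc_M_less: "odd (length xs) \<Longrightarrow> 2 * cyc_M xs < length xs"
  using cyc_ascents_add_descents[of xs] unfolding cyc_M_def by presburger


section \<open>Permutations consisting of one cycle\<close>

definition words :: "nat \<Rightarrow> nat list set" where
  "words m = {xs. distinct xs \<and> set xs = {1..m}}"

lemma length_words: "xs \<in> words m \<Longrightarrow> length xs = m"
  unfolding words_def using distinct_card[of xs] by auto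

lemma rotate_in_words: "rotate k xs \<in> words m \<longleftrightarrow> xs \<in> words m"
  by (simp add: words_def)

lemma funpow_cycle_of_list_nth:
  assumes "distinct xs" "k < length xs"
  shows "(cycle_of_list xs ^^ i) (xs ! k) = xs ! ((i + k) mod length xs)"
  using arg_cong[OF cyclic_rotation[OF assms(1), of i], of "\<lambda>ys. ys ! k"] assms
  by (simp add: nth_rotate)

text \<open>Iterating the cycle from one of its letters reads the word cyclically from there;
  distinctness of the letters puts the first return after exactly one full turn.\<close>

lemma support_cycle_of_list:
  assumes "distinct xs" "k < length xs"
  shows "support (cycle_of_list xs) (xs ! k) = rotate k xs"
proof -
  have nth: "(cycle_of_list xs ^^ i) (xs ! k) = xs ! ((i + k) mod length xs)" for i
    using funpow_cycle_of_list_nth[OF assms] .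
  have "least_power (cycle_of_list xs) (xs ! k) = length xs"
    unfolding least_power_def
  proof (rule Least_equality)
    show "(cycle_of_list xs ^^ length xs) (xs ! k) = xs ! k \<and> 0 < length xs"
      using assms by (auto simp: nth)
  next
    fix y assume y: "(cycle_of_list xs ^^ y) (xs ! k) = xs ! k \<and> 0 < y"
    have "(y + k) mod length xs < length xs"
      using assms by (intro mod_less_divisor) auto
    then have "(y + k) mod length xs = k"
      using y assms nth_eq_iff_index_eq[OF assms(1)] by (simp add: nth)
    then have "(y + k) mod length xs = (0 + k) mod length xs"
      using assms by simp
    then have "length xs dvd y"
      by (metis add_diff_cancel_right' add_0 le_add2 mod_eq_dvd_iff_nat)
    then show "length xs \<le> y" using y by (simp add: dvd_imp_le)
  qed
  then show ?thesis
    by (intro nth_equalityI) (auto simp: nth nth_rotate add.commute)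
qed

text \<open>The common cycle is read from the first letter of \<open>ys\<close>: this gives
  \<open>ys\<close> itself on one side and a rotation of \<open>xs\<close> on the other.\<close>

lemma cycle_of_list_eq_imp_rotate:
  assumes "distinct xs" "distinct ys" "set xs = set ys" "cycle_of_list xs = cycle_of_list ys"
  shows "\<exists>k. ys = rotate k xs"
proof (cases "ys = []")
  case True
  then show ?thesis using assms by auto
next
  case False
  then have "ys ! 0 \<in> set xs" using assms by auto
  then obtain k where k: "k < length xs" "xs ! k = ys ! 0"
    by (auto simp: in_set_conv_nth)
  have "rotate k xs = support (cycle_of_list xs) (xs ! k)"
    using support_cycle_of_list[OF assms(1) k(1)] by simp
  also have "\<dots> = support (cycle_of_list ys) (ys ! 0)"
    using assms k by simp
  also have "\<dots> = ys"
    using support_cycle_of_list[OF assms(2), of 0] False by simp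
  finally show ?thesis by metis
qed

text \<open>All letters share one cycle, whose normalized form starts at \<open>1\<close>. That form
  is a rotation of \<open>xs\<close>, so it has the same \<open>cyc_M\<close>.\<close>

lemma cycle_of_list_in_odd_cycle_perms:
  assumes xs: "xs \<in> words m" and "odd m"
  shows "cycle_of_list xs \<in> odd_cycle_perms m (cyc_M xs)"
proof -
  let ?p = "cycle_of_list xs"
  have dist: "distinct xs" and set: "set xs = {1..m}" and len: "length xs = m"
    using xs length_words by (auto simp: words_def)
  have "1 \<in> set xs" using set \<open>odd m\<close> by (cases m) auto
  then obtain k where k: "k < length xs" "xs ! k = 1"
    by (auto simp: in_set_conv_nth)
  have supp: "set (support ?p x) = {1..m}" if "x \<in> {1..m}" for x
  proof -
    obtain j where "j < length xs" "xs ! j = x"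
      using \<open>x \<in> {1..m}\<close> set by (metis in_set_conv_nth)
    then show ?thesis
      using support_cycle_of_list[OF dist, of j] set by (metis set_rotate)
  qed
  have "cycles_of m ?p = {support ?p 1}"
  proof -
    have "x = 1" if x: "x \<in> {1..m}" and "\<forall>y\<in>set (support ?p x). x \<le> y" for x
      using bspec[OF that(2)[unfolded supp[OF x]], of 1] x by simp
    moreover have "1 \<in> {1..m}" using \<open>1 \<in> set xs\<close> set by simp
    moreover from this have "\<forall>y\<in>set (support ?p 1). 1 \<le> y"
      unfolding supp[OF \<open>1 \<in> {1..m}\<close>] by simp
    ultimately show ?thesis unfolding cycles_of_def by blast
  qed
  also have "support ?p 1 = rotate k xs"
    using support_cycle_of_list[OF dist k(1)] k(2) by simp
  finally have "cycles_of m ?p = {rotate k xs}" .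
  then show ?thesis
    using cycle_permutes[of xs] set len \<open>odd m\<close>
    by (simp add: odd_cycle_perms_def perm_M_def cyc_M_rotate)
qed

lemma sum_length_cycles_of_le:
  assumes p: "p permutes {1..m}"
  shows "finite (cycles_of m p)" "(\<Sum>c\<in>cycles_of m p. length c) \<le> m"
proof -
  have perm: "permutation p" using p by (auto simp: permutation_permutes)
  have sub: "set (support p x) \<subseteq> {1..m}" if "x \<in> {1..m}" for x
    using that permutes_in_image[OF permutes_funpow[OF p]] by auto
  have self: "x \<in> set (support p x)" for x
    unfolding support_set[OF perm] by (metis funpow_0 rangeI)
  show fin: "finite (cycles_of m p)"
    by (rule finite_subset[of _ "support p ` {1..m}"]) (auto simp: cycles_of_def)
  have disj: "set c \<inter> set d = {}" if cd: "c \<in> cycles_of m p" "d \<in> cycles_of m p" "c \<noteq> d" for c d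
  proof -
    obtain x where c: "c = support p x" and x: "\<forall>y\<in>set (support p x). x \<le> y"
      using cd(1) unfolding cycles_of_def by blast
    obtain z where d: "d = support p z" and z: "\<forall>y\<in>set (support p z). z \<le> y"
      using cd(2) unfolding cycles_of_def by blast
    show ?thesis
    \<comment> \<open>An overlap puts each starting point on the other cycle. Both are least
      elements, so they agree.\<close>
    proof (rule ccontr)
      assume ne: "set c \<inter> set d \<noteq> {}"
      then have "x \<in> set (support p z)"
        unfolding c d using disjoint_support'[OF perm] by blast
      moreover have "z \<in> set (support p x)"
        using ne unfolding c d using disjoint_support'[OF perm, of z x] by blast
      ultimately have "x = z" using x z by (meson order_antisym)
      then show False using cd c d by simp
    qed
  qed
  have "length c = card (set c)" if "c \<in> cycles_of m p" for c
    using that distinct_card[OF cycle_of_permutation[OF perm]] unfolding cycles_of_def by force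
  then have "(\<Sum>c\<in>cycles_of m p. length c) = (\<Sum>c\<in>cycles_of m p. card (set c))"
    by simp
  also have "\<dots> = card (\<Union>c\<in>cycles_of m p. set c)"
    using fin disj by (subst card_UN_disjoint) auto
  also have "\<dots> \<le> card {1..m}"
  proof (rule card_mono)
    show "(\<Union>c\<in>cycles_of m p. set c) \<subseteq> {1..m}"
      using sub unfolding cycles_of_def by blast
  qed simp
  finally show "(\<Sum>c\<in>cycles_of m p. length c) \<le> m" by simp
qed

text \<open>An odd cycle \<open>c\<close> satisfies \<open>2 * cyc_M c + 1 \<le> length c\<close>.
  Summing over all cycles, \<open>2 * n\<close> plus the number of cycles is at most
  \<open>2 * n + 1\<close>, which leaves room for one cycle only.\<close>

lemma odd_cycle_perms_single_cycle:
  assumes "p \<in> odd_cycle_perms (2 * n + 1) n"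
  shows "\<exists>xs \<in> words (2 * n + 1). cyc_M xs = n \<and> p = cycle_of_list xs"
proof -
  let ?m = "2 * n + 1"
  let ?C = "cycles_of ?m p"
  have p: "p permutes {1..?m}" and odd: "\<And>c. c \<in> ?C \<Longrightarrow> odd (length c)"
    and M: "(\<Sum>c\<in>?C. cyc_M c) = n"
    using assms by (auto simp: odd_cycle_perms_def perm_M_def)
  have perm: "permutation p" using p by (auto simp: permutation_permutes)
  have fin: "finite ?C" and len: "(\<Sum>c\<in>?C. length c) \<le> ?m"
    using sum_length_cycles_of_le[OF p] by auto
  define xs where "xs = support p 1"
  have sub: "set xs \<subseteq> {1..?m}"
    unfolding xs_def using permutes_in_image[OF permutes_funpow[OF p], of _ 1] by auto
  then have "\<forall>y\<in>set (support p 1). 1 \<le> y"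
    unfolding xs_def by (meson atLeastAtMost_iff subsetD)
  moreover have "1 \<in> {1..?m}" by simp
  ultimately have C1: "xs \<in> ?C"
    unfolding cycles_of_def xs_def by blast
  have "2 * n + card ?C = (\<Sum>c\<in>?C. 2 * cyc_M c + 1)"
    by (simp only: sum.distrib sum_distrib_left[symmetric] M card_eq_sum)
  also have "\<dots> \<le> (\<Sum>c\<in>?C. length c)"
    using double_cyc_M_less[OF odd] by (intro sum_mono) fastforce
  finally have "card ?C \<le> 1" using len by simp
  then have C: "?C = {xs}"
    using C1 fin card_le_Suc0_iff_eq[OF fin] by auto
  have dist: "distinct xs" unfolding xs_def by (rule cycle_of_permutation[OF perm])
  have cM: "cyc_M xs = n" using M C by simp
  \<comment> \<open>The strict bound \<open>2 * n < length xs\<close> makes this cycle long enough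
    to exhaust \<open>{1..2 * n + 1}\<close>.\<close>
  then have "?m \<le> card (set xs)"
    using double_cyc_M_less[OF odd[OF C1]] distinct_card[OF dist] by simp
  then have set: "set xs = {1..?m}"
    using sub by (intro card_seteq) auto
  have "p = cycle_of_list xs"
  proof
    fix y
    show "p y = cycle_of_list xs y"
    proof (cases "y \<in> set xs")
      case True
      then show ?thesis unfolding xs_def by (rule cycle_restrict[OF perm])
    next
      case False
      then show ?thesis using p set by (simp add: id_outside_supp permutes_def)
    qed
  qed
  then show ?thesis using dist set cM by (auto simp: words_def)
qed

text \<open>The hypotheses say that \<open>T\<close> contains exactly one word from each rotation
  class with \<open>cyc_M\<close> equal to \<open>n\<close>. It is applied to two such choices: the
  ballot words, and the words ending in the maximal letter.\<close>

lemma bij_betw_cycle_of_list_transversal: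
  assumes T: "T \<subseteq> {xs \<in> words (2 * n + 1). cyc_M xs = n}"
    and ex: "\<And>xs. xs \<in> words (2 * n + 1) \<Longrightarrow> cyc_M xs = n \<Longrightarrow> \<exists>k. rotate k xs \<in> T"
    and uniq: "\<And>xs k. xs \<in> T \<Longrightarrow> rotate k xs \<in> T \<Longrightarrow> rotate k xs = xs"
  shows "bij_betw cycle_of_list T (odd_cycle_perms (2 * n + 1) n)"
  unfolding bij_betw_def
proof
  show "inj_on cycle_of_list T"
  proof (rule inj_onI)
    fix xs ys assume "xs \<in> T" "ys \<in> T" "cycle_of_list xs = cycle_of_list ys"
    moreover from this obtain k where "ys = rotate k xs"
      using T cycle_of_list_eq_imp_rotate[of xs ys] unfolding words_def by blast
    ultimately show "xs = ys" using uniq by metis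
  qed
  show "cycle_of_list ` T = odd_cycle_perms (2 * n + 1) n"
  proof
    show "cycle_of_list ` T \<subseteq> odd_cycle_perms (2 * n + 1) n"
      using T cycle_of_list_in_odd_cycle_perms[of _ "2 * n + 1"] by fastforce
    show "odd_cycle_perms (2 * n + 1) n \<subseteq> cycle_of_list ` T"
    proof
      fix p assume "p \<in> odd_cycle_perms (2 * n + 1) n"
      then obtain xs where xs: "xs \<in> words (2 * n + 1)" "cyc_M xs = n" "p = cycle_of_list xs"
        using odd_cycle_perms_single_cycle by blast
      then obtain k where "rotate k xs \<in> T" using ex by blast
      moreover have "p = cycle_of_list (rotate k xs)"
        using xs cycle_of_list_rotate_independent[of xs k] by (simp add: words_def)
      ultimately show "p \<in> cycle_of_list ` T" by blast
    qed
  qed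
qed


section \<open>One-line words\<close>

text \<open>This names the list inside \<open>word_to_cycle\<close>, which is thus
  \<open>cycle_of_list\<close> after \<open>one_line m\<close>.\<close>

definition one_line :: "nat \<Rightarrow> (nat \<Rightarrow> nat) \<Rightarrow> nat list" where
  "one_line m \<pi> = map \<pi> [1..<m + 1]"

lemma length_one_line [simp]: "length (one_line m \<pi>) = m"
  by (simp add: one_line_def)

lemma nth_one_line: "i < m \<Longrightarrow> one_line m \<pi> ! i = \<pi> (Suc i)"
  by (simp add: one_line_def del: upt_Suc)

lemma bij_betw_one_line: "bij_betw (one_line m) {\<pi>. \<pi> permutes {1..m}} (words m)"
  unfolding bij_betw_def
proof
  have nth: "\<pi> i = one_line m \<pi> ! (i - 1)" if "i \<in> {1..m}" for \<pi> i
    using that nth_one_line[of "i - 1" m \<pi>] by (cases i) simp_all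
  show "inj_on (one_line m) {\<pi>. \<pi> permutes {1..m}}"
  proof (rule inj_onI, rule ext)
    fix \<pi> \<rho> i assume "\<pi> \<in> {\<pi>. \<pi> permutes {1..m}}" "\<rho> \<in> {\<pi>. \<pi> permutes {1..m}}"
      and "one_line m \<pi> = one_line m \<rho>"
    then show "\<pi> i = \<rho> i"
      by (cases "i \<in> {1..m}") (simp_all only: nth mem_Collect_eq permutes_not_in not_False_eq_True)
  qed
  have set: "set [1..<m + 1] = {1..m}" by auto
  show "one_line m ` {\<pi>. \<pi> permutes {1..m}} = words m"
  proof
    show "one_line m ` {\<pi>. \<pi> permutes {1..m}} \<subseteq> words m"
    proof
      fix xs assume "xs \<in> one_line m ` {\<pi>. \<pi> permutes {1..m}}"
      then obtain \<pi> where p: "\<pi> permutes {1..m}" and xs: "xs = one_line m \<pi>" by blast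
      show "xs \<in> words m"
        unfolding xs one_line_def words_def mem_Collect_eq distinct_map set_map set
        using permutes_image[OF p] permutes_inj_on[OF p] by simp
    qed
    show "words m \<subseteq> one_line m ` {\<pi>. \<pi> permutes {1..m}}"
    proof
      fix xs assume xs: "xs \<in> words m"
      \<comment> \<open>Letters are counted from \<open>1\<close> and list entries from
        \<open>0\<close>; outside \<open>{1..m}\<close> the value is \<open>i\<close>, as
        \<open>permutes\<close> requires.\<close>
      define \<pi> where "\<pi> i = (if i \<in> {1..m} then xs ! (i - 1) else i)" for i
      have len: "length xs = m" using xs by (rule length_words)
      have eq: "one_line m \<pi> = xs"
        by (intro nth_equalityI) (simp_all add: len nth_one_line \<pi>_def)
      have "bij_betw \<pi> {1..m} {1..m}"
        using xs unfolding eq[symmetric] words_def one_line_def mem_Collect_eq distinct_map set_map set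
        by (simp add: bij_betw_def)
      then have "\<pi> permutes {1..m}"
        by (rule bij_imp_permutes) (auto simp: \<pi>_def)
      then show "xs \<in> one_line m ` {\<pi>. \<pi> permutes {1..m}}" using eq by blast
    qed
  qed
qed

lemma one_line_in_words: "\<pi> permutes {1..m} \<Longrightarrow> one_line m \<pi> \<in> words m"
  using bij_betw_one_line[of m] by (auto simp: bij_betw_def)

lemma cyc_step_one_line:
  assumes "Suc i < m"
  shows "cyc_step (one_line m \<pi>) i = (if \<pi> (Suc i) \<le> \<pi> (Suc (Suc i)) then 1 else -1)"
  using assms by (simp add: cyc_step_def nth_one_line)

text \<open>Positions shift by one between permutation and list. Injectivity makes
  \<open>\<le>\<close> strict, and \<open>j < m\<close> keeps out the step that wraps
  around.\<close>

lemma ascents_eq_card_steps: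
  assumes "\<pi> permutes {1..m}" "j < m"
  shows "ascents \<pi> j = card {i. i < j \<and> cyc_step (one_line m \<pi>) i = 1}"
proof -
  have "{i \<in> {1..j}. \<pi> i < \<pi> (i + 1)} = Suc ` {i. i < j \<and> cyc_step (one_line m \<pi>) i = 1}"
  proof -
    have "\<pi> (Suc i) \<noteq> \<pi> (Suc (Suc i))" for i
      using permutes_inj[OF assms(1)] by (simp add: inj_eq)
    then have "\<pi> (Suc i) < \<pi> (Suc (Suc i)) \<longleftrightarrow> cyc_step (one_line m \<pi>) i = 1" if "i < j" for i
      using that assms(2) by (simp add: cyc_step_one_line le_less)
    then show ?thesis
      by (auto simp: image_iff Suc_le_eq gr0_conv_Suc)
  qed
  then show ?thesis by (simp add: ascents_def card_image)
qed

lemma descents_eq_card_steps: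
  assumes "j < m"
  shows "descents \<pi> j = card {i. i < j \<and> cyc_step (one_line m \<pi>) i = -1}"
proof -
  have "{i \<in> {1..j}. \<pi> i > \<pi> (i + 1)} = Suc ` {i. i < j \<and> cyc_step (one_line m \<pi>) i = -1}"
  proof -
    have "\<pi> (Suc i) > \<pi> (Suc (Suc i)) \<longleftrightarrow> cyc_step (one_line m \<pi>) i = -1" if "i < j" for i
      using that assms by (auto simp: cyc_step_one_line)
    then show ?thesis
      by (auto simp: image_iff Suc_le_eq gr0_conv_Suc)
  qed
  then show ?thesis by (simp add: descents_def card_image)
qed

lemma ascents_add_descents:
  assumes "\<pi> permutes {1..m}" "j < m"
  shows "ascents \<pi> j + descents \<pi> j = j"
  using card_steps[of j "one_line m \<pi>"] ascents_eq_card_steps[OF assms]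
    descents_eq_card_steps[OF assms(2), of \<pi>] by simp

lemma height_one_line:
  assumes "\<pi> permutes {1..m}" "j < m"
  shows "height (one_line m \<pi>) j = int (ascents \<pi> j) - int (descents \<pi> j)"
  using height_eq_card_diff[of "one_line m \<pi>" j] ascents_eq_card_steps[OF assms]
    descents_eq_card_steps[OF assms(2), of \<pi>] by simp


section \<open>Two transversals of the rotation classes\<close>

text \<open>The ballot condition is nonnegativity of the heights, and \<open>n\<close> descents
  among \<open>2 * n\<close> steps mean a return to height \<open>0\<close>.\<close>

lemma ballot_perms_iff_balanced:
  assumes p: "\<pi> permutes {1..2 * n + 1}"
  shows "\<pi> \<in> ballot_perms (2 * n + 1) n \<longleftrightarrow>
    balanced_from (2 * n + 1) (height (one_line (2 * n + 1) \<pi>)) 0"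
proof -
  have "ballot (2 * n + 1) \<pi> \<longleftrightarrow> (\<forall>j<2 * n + 1. 0 \<le> height (one_line (2 * n + 1) \<pi>) j)"
    (is "?L \<longleftrightarrow> ?R")
  proof
    assume L: ?L
    show ?R
    proof (intro allI impI)
      fix j assume j: "j < 2 * n + 1"
      show "0 \<le> height (one_line (2 * n + 1) \<pi>) j"
        using L j height_one_line[OF p j] by (cases "j = 0") (auto simp: ballot_def)
    qed
  next
    assume R: ?R
    show ?L
      unfolding ballot_def
    proof (intro allI impI)
      fix k assume "1 \<le> k \<and> k \<le> 2 * n + 1 - 1"
      then have k: "k < 2 * n + 1" by linarith
      show "descents \<pi> k \<le> ascents \<pi> k"
        using R[rule_format, OF k] height_one_line[OF p k] by simp
    qed
  qed
  moreover have "descents \<pi> (2 * n) = n \<longleftrightarrow> height (one_line (2 * n + 1) \<pi>) (2 * n) = 0"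
    using height_one_line[OF p, of "2 * n"] ascents_add_descents[OF p, of "2 * n"] by auto
  ultimately show ?thesis
    using p by (simp add: ballot_perms_def balanced_from_def)
qed

lemma bij_betw_ballot_perms:
  "bij_betw (word_to_cycle (2 * n + 1)) (ballot_perms (2 * n + 1) n) (odd_cycle_perms (2 * n + 1) n)"
proof -
  let ?m = "2 * n + 1"
  define T where "T = {xs \<in> words ?m. balanced_from ?m (height xs) 0}"
  have "bij_betw (one_line ?m) (ballot_perms ?m n) T"
  proof (rule bij_betw_subset[OF bij_betw_one_line])
    show "ballot_perms ?m n \<subseteq> {\<pi>. \<pi> permutes {1..?m}}"
      by (auto simp: ballot_perms_def)
    show "one_line ?m ` ballot_perms ?m n = T"
    proof (intro equalityI subsetI)
      fix xs assume "xs \<in> one_line ?m ` ballot_perms ?m n"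
      then obtain \<pi> where "\<pi> permutes {1..?m}" "\<pi> \<in> ballot_perms ?m n" "xs = one_line ?m \<pi>"
        by (auto simp: ballot_perms_def)
      then show "xs \<in> T"
        using ballot_perms_iff_balanced one_line_in_words unfolding T_def by blast
    next
      fix xs assume xs: "xs \<in> T"
      then obtain \<pi> where "\<pi> permutes {1..?m}" "xs = one_line ?m \<pi>"
        using bij_betw_one_line[of ?m] unfolding T_def bij_betw_def by blast
      then show "xs \<in> one_line ?m ` ballot_perms ?m n"
        using xs ballot_perms_iff_balanced unfolding T_def by blast
    qed
  qed
  moreover have "bij_betw cycle_of_list T (odd_cycle_perms ?m n)"
  proof (rule bij_betw_cycle_of_list_transversal)
    have M: "cyc_M xs = n" if "xs \<in> T" for xs
    proof -
      have len: "length xs = ?m" using that length_words by (auto simp: T_def)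
      have "height xs (2 * n) = 0" using that by (simp add: T_def balanced_from_def)
      \<comment> \<open>Only the step from the last letter back to the first remains after height
        \<open>0\<close>.\<close>
      then have "\<bar>height xs (length xs)\<bar> = 1"
        using abs_height_step[of xs "2 * n"] len by simp
      then show ?thesis using cyc_M_eq_iff[OF len] by simp
    qed
    then show "T \<subseteq> {xs \<in> words ?m. cyc_M xs = n}" by (auto simp: T_def)
    show "\<exists>k. rotate k xs \<in> T" if xs: "xs \<in> words ?m" and "cyc_M xs = n" for xs
    proof -
      have len: "length xs = ?m" using xs by (rule length_words)
      have "\<bar>height xs (length xs)\<bar> = 1" using cyc_M_eq_iff[OF len] that by simp
      then obtain k where "balanced_from (length xs) (height xs) k"
        using balanced_from_exists[of "length xs" "height xs"] height_period abs_height_step len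
        by (metis add_gr_0 zero_less_one)
      then have "balanced_from ?m (height (rotate k xs)) 0"
        using len balanced_from_height_rotate[of xs] by fastforce
      then show ?thesis
        using xs unfolding T_def by (auto simp: rotate_in_words)
    qed
    show "rotate k xs = xs" if xs: "xs \<in> T" and rot: "rotate k xs \<in> T" for xs k
    proof (rule ccontr)
      assume ne: "rotate k xs \<noteq> xs"
      have len: "length xs = ?m" using xs length_words by (auto simp: T_def)
      \<comment> \<open>Reducing the rotation modulo the length places the second starting point
        strictly between \<open>0\<close> and one full period, as uniqueness requires.\<close>
      define l where "l = k mod length xs"
      have rot_l: "rotate l xs = rotate k xs" unfolding l_def by (rule rotate_conv_mod[symmetric])
      have "0 < l" using ne rotate_id[of k xs] unfolding l_def by blast
      moreover have "l < 0 + length xs" unfolding l_def using len by simp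
      moreover have "\<bar>height xs (length xs)\<bar> = 1"
        using cyc_M_eq_iff[OF len] M[OF xs] by simp
      moreover have "balanced_from (length xs) (height xs) 0"
        using xs len by (simp add: T_def)
      moreover have "balanced_from (length xs) (height xs) l"
        using rot len balanced_from_height_rotate[of xs _ l] by (fastforce simp: T_def simp flip: rot_l)
      ultimately show False
        using balanced_from_unique[of "height xs" "length xs" "height xs (length xs)" 0 l]
          height_period by blast
    qed
  qed
  ultimately have "bij_betw (cycle_of_list \<circ> one_line ?m) (ballot_perms ?m n) (odd_cycle_perms ?m n)"
    by (rule bij_betw_trans)
  then show ?thesis
    by (simp add: word_to_cycle_def one_line_def comp_def cong: bij_betw_cong)
qed

text \<open>
  A permutation of \<open>{1..2 n}\<close> fixes \<open>2 n + 1\<close>, so its one-line word of length \<open>2 n + 1\<close> is its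
  usual word followed by the maximal letter. The two steps next to the maximum cancel.
\<close>

lemma permutes_atLeastAtMost_Suc_iff:
  "\<pi> permutes {1..m} \<longleftrightarrow> \<pi> permutes {1..Suc m} \<and> \<pi> (Suc m) = Suc m"
proof
  assume p: "\<pi> permutes {1..m}"
  then have "\<pi> permutes {1..Suc m}" by (rule permutes_subset) auto
  moreover have "\<pi> (Suc m) = Suc m" using p by (simp add: permutes_def)
  ultimately show "\<pi> permutes {1..Suc m} \<and> \<pi> (Suc m) = Suc m" by simp
next
  assume p: "\<pi> permutes {1..Suc m} \<and> \<pi> (Suc m) = Suc m"
  show "\<pi> permutes {1..m}"
  proof (rule permutes_superset)
    show "\<pi> permutes {1..Suc m}" using p by simp
    show "\<And>x. x \<in> {1..Suc m} - {1..m} \<Longrightarrow> \<pi> x = x"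
      using p by (auto simp: le_Suc_eq)
  qed
qed

lemma height_one_line_max:
  assumes p: "\<pi> permutes {1..m}" and "m > 0"
  shows "height (one_line (Suc m) \<pi>) (Suc m) = int m - 1 - 2 * int (descents \<pi> (m - 1))"
proof -
  have p': "\<pi> permutes {1..Suc m}" and fixed: "\<pi> (Suc m) = Suc m"
    using p permutes_atLeastAtMost_Suc_iff by blast+
  have small: "\<pi> i \<le> m" if "1 \<le> i" "i \<le> m" for i
    using permutes_in_image[OF p, of i] that by auto
  obtain l where l: "m = Suc l" using \<open>m > 0\<close> gr0_conv_Suc by auto
  have "cyc_step (one_line (Suc m) \<pi>) l = 1"
    using l fixed small[of m] by (simp add: cyc_step_one_line)
  moreover have "cyc_step (one_line (Suc m) \<pi>) m = -1"
    using l fixed small[of 1] by (simp add: cyc_step_def nth_one_line)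
  ultimately have "height (one_line (Suc m) \<pi>) (Suc m) = height (one_line (Suc m) \<pi>) l"
    by (simp add: l height_Suc)
  also have "\<dots> = int (ascents \<pi> l) - int (descents \<pi> l)"
    using height_one_line[OF p', of l] l by simp
  also have "\<dots> = int l - 2 * int (descents \<pi> l)"
    using ascents_add_descents[OF p', of l] l by simp
  finally show ?thesis by (simp add: l)
qed

text \<open>Distinct letters make the rotation with the maximum last unique, so these words form a
  second transversal. Deleting the maximum turns the condition on \<open>cyc_M\<close> into one on
  descents.\<close>

lemma bij_betw_max_last:
  assumes "n > 0"
  shows "bij_betw (cycle_of_list \<circ> one_line (2 * n + 1))
    {\<pi>. \<pi> permutes {1..2 * n} \<and> descents \<pi> (2 * n - 1) \<in> {n - 1, n}} (odd_cycle_perms (2 * n + 1) n)"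
    (is "bij_betw _ ?A _")
proof -
  let ?m = "2 * n + 1"
  define T where "T = {xs \<in> words ?m. cyc_M xs = n \<and> xs ! (2 * n) = ?m}"
  have A: "\<pi> \<in> ?A \<longleftrightarrow> one_line ?m \<pi> \<in> T" if p: "\<pi> permutes {1..?m}" for \<pi>
  proof (cases "\<pi> ?m = ?m")
    case True
    then have p': "\<pi> permutes {1..2 * n}"
      using p permutes_atLeastAtMost_Suc_iff[of \<pi> "2 * n"] by simp
    have "one_line ?m \<pi> \<in> T \<longleftrightarrow> cyc_M (one_line ?m \<pi>) = n"
      using True one_line_in_words[OF p] by (simp add: T_def nth_one_line)
    also have "\<dots> \<longleftrightarrow> \<bar>height (one_line ?m \<pi>) ?m\<bar> = 1"
      using cyc_M_eq_iff[of "one_line ?m \<pi>" n] by simp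
    \<comment> \<open>The height is \<open>2 * n - 1 - 2 * d\<close> for \<open>d\<close> descents;
      the values \<open>1\<close> and \<open>-1\<close> correspond to \<open>d = n - 1\<close> and
      \<open>d = n\<close>.\<close>
    also have "\<dots> \<longleftrightarrow> descents \<pi> (2 * n - 1) \<in> {n - 1, n}"
      using height_one_line_max[OF p'] assms by auto
    finally show ?thesis using p' by simp
  next
    case False
    then have "\<not> \<pi> permutes {1..2 * n}"
      using permutes_atLeastAtMost_Suc_iff[of \<pi> "2 * n"] by simp
    then show ?thesis using False by (simp add: T_def nth_one_line)
  qed
  have sub: "?A \<subseteq> {\<pi>. \<pi> permutes {1..?m}}"
    using permutes_atLeastAtMost_Suc_iff[of _ "2 * n"] by auto
  have "bij_betw (one_line ?m) ?A T"
  proof (rule bij_betw_subset[OF bij_betw_one_line sub])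
    show "one_line ?m ` ?A = T"
    proof (intro equalityI subsetI)
      fix xs assume "xs \<in> one_line ?m ` ?A"
      then show "xs \<in> T" using sub A by blast
    next
      fix xs assume xs: "xs \<in> T"
      then obtain \<pi> where "\<pi> permutes {1..?m}" "xs = one_line ?m \<pi>"
        using bij_betw_one_line[of ?m] unfolding T_def bij_betw_def by blast
      then show "xs \<in> one_line ?m ` ?A" using xs A by blast
    qed
  qed
  moreover have "bij_betw cycle_of_list T (odd_cycle_perms ?m n)"
  proof (rule bij_betw_cycle_of_list_transversal)
    show "T \<subseteq> {xs \<in> words ?m. cyc_M xs = n}" by (auto simp: T_def)
    show "\<exists>k. rotate k xs \<in> T" if xs: "xs \<in> words ?m" "cyc_M xs = n" for xs
    proof -
      have len: "length xs = ?m" using xs(1) by (rule length_words)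
      have "?m \<in> set xs" using xs by (simp add: words_def)
      then obtain i where i: "i < length xs" "xs ! i = ?m" by (auto simp: in_set_conv_nth)
      \<comment> \<open>Rotating by \<open>Suc i\<close> carries the entry at index \<open>i\<close>
        to the last index \<open>2 * n\<close>.\<close>
      have "rotate (Suc i) xs ! (2 * n) = xs ! ((Suc i + 2 * n) mod length xs)"
        using len by (intro nth_rotate) simp
      also have "(Suc i + 2 * n) mod length xs = i"
        using i len by (metis add_Suc_shift mod_add_self2 mod_less Suc_eq_plus1)
      finally have "rotate (Suc i) xs \<in> T"
        using i xs unfolding T_def by (simp only: mem_Collect_eq rotate_in_words cyc_M_rotate)
      then show ?thesis ..
    qed
    show "rotate k xs = xs" if xs: "xs \<in> T" and rot: "rotate k xs \<in> T" for xs k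
    proof -
      have len: "length xs = ?m" and dist: "distinct xs"
        using xs length_words by (auto simp: T_def words_def)
      have "xs ! ((k + 2 * n) mod length xs) = xs ! (2 * n)"
        using rot xs nth_rotate[of "2 * n" xs k] len by (simp add: T_def)
      then have "(k + 2 * n) mod length xs = 2 * n"
        using nth_eq_iff_index_eq[OF dist] len by simp
      then have "(k + 2 * n) mod length xs = (0 + 2 * n) mod length xs"
        using len by simp
      then have "length xs dvd k"
        by (metis add_diff_cancel_right' add_0 le_add2 mod_eq_dvd_iff_nat)
      then show ?thesis by (intro rotate_id) simp
    qed
  qed
  ultimately show ?thesis by (rule bij_betw_trans)
qed

section \<open>Complementation and the Eulerian-Catalan count\<close>

text \<open>Complementing the letters swaps ascents and descents among the \<open>m - 1\<close>
  positions and is an involution.\<close>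

lemma eulerian_symmetric:
  assumes "d < m"
  shows "eulerian m d = eulerian m (m - 1 - d)"
proof -
  define c where "c i = (if i \<in> {1..m} then m + 1 - i else i)" for i
  have cc: "c (c i) = i" for i by (auto simp: c_def)
  have c: "c permutes {1..m}"
    by (rule bij_imp_permutes, rule bij_betwI[of _ _ _ c]) (simp_all add: cc, auto simp: c_def)
  have desc: "descents (c \<circ> \<pi>) (m - 1) = m - 1 - descents \<pi> (m - 1)" if p: "\<pi> permutes {1..m}" for \<pi>
  proof -
    have range: "\<pi> i \<in> {1..m}" if "i \<in> {1..m}" for i
      using permutes_in_image[OF p] that by blast
    have "c (\<pi> (i + 1)) < c (\<pi> i) \<longleftrightarrow> \<pi> i < \<pi> (i + 1)" if "i \<in> {1..m - 1}" for i
    proof -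
      have "i \<in> {1..m}" "i + 1 \<in> {1..m}" using that by auto
      from this[THEN range] show ?thesis by (auto simp: c_def)
    qed
    then have "descents (c \<circ> \<pi>) (m - 1) = ascents \<pi> (m - 1)"
      unfolding descents_def ascents_def by (intro arg_cong[of _ _ card]) auto
    then show ?thesis
      using ascents_add_descents[OF p, of "m - 1"] assms by auto
  qed
  have "bij_betw ((\<circ>) c) {\<pi>. \<pi> permutes {1..m} \<and> descents \<pi> (m - 1) = d}
      {\<pi>. \<pi> permutes {1..m} \<and> descents \<pi> (m - 1) = m - 1 - d}"
  proof (rule bij_betwI[of _ _ _ "(\<circ>) c"])
    show "c \<circ> (c \<circ> \<pi>) = \<pi>" for \<pi> :: "nat \<Rightarrow> nat" by (simp add: fun_eq_iff cc)
    then show "c \<circ> (c \<circ> \<pi>) = \<pi>" for \<pi> :: "nat \<Rightarrow> nat" .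
  qed (use desc assms permutes_compose[OF _ c] in auto)
  then show ?thesis unfolding eulerian_def by (rule bij_betw_same_card)
qed

lemma card_odd_cycle_perms: "card (odd_cycle_perms (2 * n + 1) n) = eulerian_catalan n"
proof (cases "n = 0")
  case True
  \<comment> \<open>The case \<open>n = 0\<close> has its own value in
    \<open>eulerian_catalan\<close> and is outside the scope of \<open>bij_betw_max_last\<close>;
    here the identity is the only permutation.\<close>
  have "odd_cycle_perms 1 0 = {id}"
  proof (intro equalityI subsetI)
    fix p assume "p \<in> odd_cycle_perms 1 0"
    then show "p \<in> {id}" by (simp add: odd_cycle_perms_def permutes_sing)
  next
    fix p :: "nat \<Rightarrow> nat" assume "p \<in> {id}"
    moreover have "cyc_M [1] = 0" using double_cyc_M_less[of "[1]"] by simp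
    ultimately show "p \<in> odd_cycle_perms 1 0"
      using cycle_of_list_in_odd_cycle_perms[of "[1]" 1] by (simp add: words_def)
  qed
  then show ?thesis using True by (simp add: eulerian_catalan_def)
next
  case False
  define E where "E d = {\<pi>. \<pi> permutes {1..2 * n} \<and> descents \<pi> (2 * n - 1) = d}" for d
  have fin: "finite (E d)" for d
    by (rule finite_subset[OF _ finite_permutations[of "{1..2 * n}"]]) (auto simp: E_def)
  have "card (odd_cycle_perms (2 * n + 1) n) =
      card {\<pi>. \<pi> permutes {1..2 * n} \<and> descents \<pi> (2 * n - 1) \<in> {n - 1, n}}"
    using bij_betw_same_card[OF bij_betw_max_last] False by simp
  also have "{\<pi>. \<pi> permutes {1..2 * n} \<and> descents \<pi> (2 * n - 1) \<in> {n - 1, n}} = E (n - 1) \<union> E n"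
    by (auto simp: E_def)
  also have "card \<dots> = card (E (n - 1)) + card (E n)"
    using fin False by (intro card_Un_disjoint) (auto simp: E_def)
  \<comment> \<open>Symmetry for \<open>m = 2 * n\<close> and \<open>d = n\<close>, where
    \<open>m - 1 - d\<close> is \<open>n - 1\<close>.\<close>
  also have "card (E n) = card (E (n - 1))"
    using eulerian_symmetric[of n "2 * n"] False
    by (simp add: E_def eulerian_def mult_2)
  finally show ?thesis using False by (simp add: eulerian_catalan_def eulerian_def E_def)
qed

theorem theorem1p7:
  fixes n :: nat
  shows "card (ballot_perms (2 * n + 1) n) = card (odd_cycle_perms (2 * n + 1) n) \<and>
    card (odd_cycle_perms (2 * n + 1) n) = eulerian_catalan n \<and>
    bij_betw (word_to_cycle (2 * n + 1)) (ballot_perms (2 * n + 1) n) (odd_cycle_perms (2 * n + 1) n)"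
  using bij_betw_same_card[OF bij_betw_ballot_perms] card_odd_cycle_perms bij_betw_ballot_perms
  by blast

end
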